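(* Let $n\in\mathbb{N}$ (so $n\geq 1$) and let $A_k:\mathcal{H}\supseteq\operatorname{dom}A_k\to\mathcal{H}$, $k=0,\dots,n$, be (possibly unbounded) linear operators in a Hilbert space $\mathcal{H}$. Consider the operator polynomial $$T(\lambda)=\sum_{k=0}^n\lambda^kA_k,\qquad \operatorname{dom}T(\lambda)=\bigcap_{k=0}^n\operatorname{dom}A_k,\qquad\lambda\in\mathbb{C}.$$ If $0\notin\overline{W(A_n)}$, then $$W_\Psi(T)\subseteq\overline{W(T)}.$$ Analogously, if $\mathbf{a}_k$, $k=0,\dots,n$, are (possibly unbounded) sesquilinear forms in $\mathcal{H}$, $\mathbf{t}(\lambda)=\sum_{k=0}^n\lambda^k\mathbf{a}_k$ with $\operatorname{dom}\mathbf{t}(\lambda)=\bigcap_{k=0}^n\operatorname{dom}\mathbf{a}_k$, $\lambda\in\mathbb{C}$, and $0\notin\overline{W(\mathbf{a}_n)}$, then $W_\Psi(\mathbf{t})\subseteq\overline{W(\mathbf{t})}$.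
   Context: $\mathcal{H}$ is a complex Hilbert space. For a linear operator $A$ in $\mathcal H$, $W(A)=\{(Af,f):f\in\operatorname{dom}A,\|f\|=1\}$; for a sesquilinear form $\mathbf{a}$, $W(\mathbf{a})=\{\mathbf{a}[f]:f\in\operatorname{dom}\mathbf{a},\|f\|=1\}$ with $\mathbf{a}[f]:=\mathbf{a}[f,f]$. For families $T$, $\mathbf{t}$ indexed by $\lambda\in\Omega$ (here $\Omega=\mathbb{C}$): $W(T)=\{\lambda\in\Omega:0\in W(T(\lambda))\}$, $W(\mathbf{t})=\{\lambda\in\Omega:0\in W(\mathbf{t}(\lambda))\}$. For $\varepsilon>0$, $W_\varepsilon(T)=\bigcup_{B\in L(\mathcal{H}),\|B\|<\varepsilon}W(T+B)$ and $W_\varepsilon(\mathbf{t})=\bigcup_{\|\mathbf{b}\|<\varepsilon}W(\mathbf{t}+\mathbf{b})$ (union over bounded sesquilinear forms $\mathbf{b}$ on $\mathcal{H}$, $\|\mathbf{b}\|=\sup_{\|f\|=\|g\|=1}|\mathbf{b}[f,g]|$). The pseudo numerical ranges are $W_\Psi(T)=\bigcap_{\varepsilon>0}W_\varepsilon(T)$ and $W_\Psi(\mathbf{t})=\bigcap_{\varepsilon>0}W_\varepsilon(\mathbf{t})$. *)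

theory Defs
  imports "HOL-Analysis.Analysis"
begin

text \<open>Complex Hilbert spaces. The inner product is linear in its first argument. The norm,
  metric, real scaling and completeness come from \<^class>\<open>banach\<close>; the last two axioms tie them
  to the complex structure. The case \<open>c = 1\<close> of the unit law of scaling, and the positive
  definiteness of the inner product, follow from these two.\<close>

class chilbert_space = banach +
  fixes scaleC :: "complex \<Rightarrow> 'a \<Rightarrow> 'a" (infixr \<open>*\<^sub>C\<close> 75)
    and cinner :: "'a \<Rightarrow> 'a \<Rightarrow> complex"
  assumes scaleC_add_right: "c *\<^sub>C (x + y) = c *\<^sub>C x + c *\<^sub>C y"
    and scaleC_add_left: "(c + d) *\<^sub>C x = c *\<^sub>C x + d *\<^sub>C x"
    and scaleC_scaleC: "c *\<^sub>C (d *\<^sub>C x) = (c * d) *\<^sub>C x"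
    and cinner_add_left: "cinner (x + y) z = cinner x z + cinner y z"
    and cinner_scaleC_left: "cinner (c *\<^sub>C x) y = c * cinner x y"
    and cinner_commute: "cinner x y = cnj (cinner y x)"
    and scaleR_scaleC: "r *\<^sub>R x = complex_of_real r *\<^sub>C x"
    and cinner_self: "cinner x x = complex_of_real ((norm x)\<^sup>2)"

global_interpretation complex_vector:
  vector_space "scaleC :: complex \<Rightarrow> 'a \<Rightarrow> 'a :: chilbert_space"
proof
  fix x :: 'a
  show "1 *\<^sub>C x = x"
    using scaleR_scaleC[of 1 x] by simp
qed (simp_all add: scaleC_add_right scaleC_add_left scaleC_scaleC)

instantiation complex :: chilbert_space
begin

definition scaleC_complex :: "complex \<Rightarrow> complex \<Rightarrow> complex"
  where "scaleC_complex c x = c * x"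

definition cinner_complex :: "complex \<Rightarrow> complex \<Rightarrow> complex"
  where "cinner_complex x y = x * cnj y"

instance
  by standard
    (simp_all add: scaleC_complex_def cinner_complex_def algebra_simps scaleR_conv_of_real
      complex_norm_square del: of_real_power)

end


section \<open>Unbounded operators and forms\<close>

text \<open>Values outside the domain are irrelevant.\<close>

datatype 'a unbounded_op = Op (op_dom: "'a set") (op_app: "'a \<Rightarrow> 'a")

datatype 'a unbounded_form = Form (form_dom: "'a set") (form_app: "'a \<Rightarrow> 'a \<Rightarrow> complex")

definition linear_op :: "'a::chilbert_space unbounded_op \<Rightarrow> bool" where
  "linear_op A \<longleftrightarrow>
     complex_vector.subspace (op_dom A) \<and>
     (\<forall>f\<in>op_dom A. \<forall>g\<in>op_dom A. op_app A (f + g) = op_app A f + op_app A g) \<and>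
     (\<forall>c. \<forall>f\<in>op_dom A. op_app A (c *\<^sub>C f) = c *\<^sub>C op_app A f)"

definition sesquilinear_form :: "'a::chilbert_space unbounded_form \<Rightarrow> bool" where
  "sesquilinear_form a \<longleftrightarrow>
     complex_vector.subspace (form_dom a) \<and>
     (\<forall>f\<in>form_dom a. \<forall>g\<in>form_dom a. \<forall>h\<in>form_dom a.
        form_app a (f + g) h = form_app a f h + form_app a g h \<and>
        form_app a h (f + g) = form_app a h f + form_app a h g) \<and>
     (\<forall>c. \<forall>f\<in>form_dom a. \<forall>g\<in>form_dom a.
        form_app a (c *\<^sub>C f) g = c * form_app a f g \<and>
        form_app a f (c *\<^sub>C g) = cnj c * form_app a f g)"

definition op_add :: "'a::chilbert_space unbounded_op \<Rightarrow> 'a unbounded_op \<Rightarrow> 'a unbounded_op" where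
  "op_add A B = Op (op_dom A \<inter> op_dom B) (\<lambda>f. op_app A f + op_app B f)"

definition form_add ::
    "'a::chilbert_space unbounded_form \<Rightarrow> 'a unbounded_form \<Rightarrow> 'a unbounded_form" where
  "form_add a b = Form (form_dom a \<inter> form_dom b) (\<lambda>f g. form_app a f g + form_app b f g)"

text \<open>\<open>bounded_ops\<close> is $L(\mathcal{H})$; the norm of its elements is \<^const>\<open>onorm\<close>.\<close>

definition bounded_ops :: "('a::chilbert_space \<Rightarrow> 'a) set" where
  "bounded_ops = {B. linear_op (Op UNIV B) \<and> bounded_linear B}"

definition bounded_forms :: "('a::chilbert_space \<Rightarrow> 'a \<Rightarrow> complex) set" where
  "bounded_forms =
     {b. sesquilinear_form (Form UNIV b) \<and> (\<exists>K. \<forall>f g. cmod (b f g) \<le> K * norm f * norm g)}"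

text \<open>Only meaningful for bounded forms on a nonzero space. On the zero space the supremum is
  over the empty set, but all numerical ranges below are then empty.\<close>

definition form_norm :: "('a::chilbert_space \<Rightarrow> 'a \<Rightarrow> complex) \<Rightarrow> real" where
  "form_norm b = Sup {cmod (b f g) |f g. norm f = 1 \<and> norm g = 1}"


section \<open>Numerical ranges\<close>

definition num_range :: "'a::chilbert_space unbounded_op \<Rightarrow> complex set" where
  "num_range A = {cinner (op_app A f) f |f. f \<in> op_dom A \<and> norm f = 1}"

definition form_num_range :: "'a::chilbert_space unbounded_form \<Rightarrow> complex set" where
  "form_num_range a = {form_app a f f |f. f \<in> form_dom a \<and> norm f = 1}"

text \<open>Families are indexed by all of $\mathbb{C}$.\<close>

definition fam_num_range :: "(complex \<Rightarrow> 'a::chilbert_space unbounded_op) \<Rightarrow> complex set" where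
  "fam_num_range T = {z. 0 \<in> num_range (T z)}"

definition form_fam_num_range ::
    "(complex \<Rightarrow> 'a::chilbert_space unbounded_form) \<Rightarrow> complex set" where
  "form_fam_num_range t = {z. 0 \<in> form_num_range (t z)}"

definition eps_num_range ::
    "real \<Rightarrow> (complex \<Rightarrow> 'a::chilbert_space unbounded_op) \<Rightarrow> complex set" where
  "eps_num_range \<epsilon> T =
     (\<Union>B\<in>{B \<in> bounded_ops. onorm B < \<epsilon>}. fam_num_range (\<lambda>z. op_add (T z) (Op UNIV B)))"

definition form_eps_num_range ::
    "real \<Rightarrow> (complex \<Rightarrow> 'a::chilbert_space unbounded_form) \<Rightarrow> complex set" where
  "form_eps_num_range \<epsilon> t =
     (\<Union>b\<in>{b \<in> bounded_forms. form_norm b < \<epsilon>}.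
        form_fam_num_range (\<lambda>z. form_add (t z) (Form UNIV b)))"

definition pseudo_num_range ::
    "(complex \<Rightarrow> 'a::chilbert_space unbounded_op) \<Rightarrow> complex set" where
  "pseudo_num_range T = (\<Inter>\<epsilon>\<in>{0<..}. eps_num_range \<epsilon> T)"

definition form_pseudo_num_range ::
    "(complex \<Rightarrow> 'a::chilbert_space unbounded_form) \<Rightarrow> complex set" where
  "form_pseudo_num_range t = (\<Inter>\<epsilon>\<in>{0<..}. form_eps_num_range \<epsilon> t)"


section \<open>Polynomial families\<close>

definition op_poly ::
    "nat \<Rightarrow> (nat \<Rightarrow> 'a::chilbert_space unbounded_op) \<Rightarrow> complex \<Rightarrow> 'a unbounded_op" where
  "op_poly n A z = Op (\<Inter>k\<le>n. op_dom (A k)) (\<lambda>f. \<Sum>k\<le>n. z ^ k *\<^sub>C op_app (A k) f)"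

definition form_poly ::
    "nat \<Rightarrow> (nat \<Rightarrow> 'a::chilbert_space unbounded_form) \<Rightarrow> complex \<Rightarrow> 'a unbounded_form" where
  "form_poly n a z = Form (\<Inter>k\<le>n. form_dom (a k)) (\<lambda>f g. \<Sum>k\<le>n. z ^ k * form_app (a k) f g)"

end

theory Submission
  imports Defs "HOL-Computational_Algebra.Fundamental_Theorem_Algebra"
begin

text \<open>Every \<open>\<lambda>\<close> in the pseudo numerical range makes the scalar polynomials
  \<open>p\<^sub>f(w) = (T(w)f, f)\<close>, \<open>\<parallel>f\<parallel> = 1\<close>, arbitrarily small at \<open>\<lambda>\<close>. Their leading coefficients
  \<open>(A\<^sub>nf, f)\<close> are bounded away from zero by some \<open>d > 0\<close>. Factoring \<open>p\<^sub>f\<close> over the complex numbers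
  gives a root \<open>w\<close> with \<open>d \<bar>\<lambda> - w\<bar>\<^sup>n \<le> \<bar>p\<^sub>f(\<lambda>)\<bar>\<close>, and each such root lies in \<open>W(T)\<close>.\<close>

text \<open>Take the root nearest to \<open>z\<close>. In the factorization of \<open>p\<close> into
  linear factors, each \<open>cmod (z - root i)\<close> is at least that minimal distance, so their
  product dominates its power.\<close>

lemma exists_root_near:
  fixes p :: "complex poly"
  assumes "degree p > 0"
  shows "\<exists>w. poly p w = 0 \<and> cmod (lead_coeff p) * cmod (z - w) ^ degree p \<le> cmod (poly p z)"
proof -
  obtain root where root: "smult (lead_coeff p) (\<Prod>i<degree p. [:-root i, 1:]) = p"
    by (rule complex_poly_decompose')
  have poly_p: "poly p x = lead_coeff p * (\<Prod>i<degree p. x - root i)" for x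
    by (subst root [symmetric]) (simp add: poly_prod)
  let ?D = "(\<lambda>i. cmod (z - root i)) ` {..<degree p}"
  \<comment> \<open>Positive degree makes the set of distances nonempty, so the minimum is
    attained.\<close>
  have "Min ?D \<in> ?D"
    using assms by (intro Min_in) auto
  then obtain j where j: "j < degree p" "Min ?D = cmod (z - root j)" by auto
  have min: "cmod (z - root j) \<le> cmod (z - root i)" if "i < degree p" for i
    using that unfolding j(2) [symmetric] by simp
  have "cmod (z - root j) ^ degree p = (\<Prod>i<degree p. cmod (z - root j))"
    by simp
  also have "\<dots> \<le> (\<Prod>i<degree p. cmod (z - root i))"
    by (intro prod_mono) (auto intro: min)
  finally have "cmod (lead_coeff p) * cmod (z - root j) ^ degree p \<le> cmod (poly p z)"
    unfolding poly_p norm_mult by (intro mult_left_mono) (simp_all add: prod_norm)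
  moreover have "poly p (root j) = 0"
    unfolding poly_p using j(1) by auto
  ultimately show ?thesis by blast
qed

text \<open>The scalar core shared by operators and forms: both enter only through the coefficients
  \<open>c f k\<close> of their quadratic forms at unit vectors.\<close>

lemma closure_roots_of_poly_family:
  fixes c :: "'b \<Rightarrow> nat \<Rightarrow> complex"
  assumes n: "n \<ge> 1"
    and lead: "0 \<notin> closure {c f n |f. f \<in> F}"
    and small: "\<And>\<epsilon>. \<epsilon> > 0 \<Longrightarrow> \<exists>f\<in>F. cmod (\<Sum>k\<le>n. z ^ k * c f k) < \<epsilon>"
  shows "z \<in> closure {w. \<exists>f\<in>F. (\<Sum>k\<le>n. w ^ k * c f k) = 0}"
  unfolding closure_approachable
proof (intro allI impI)
  fix e :: real
  assume e: "e > 0"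
  obtain d where d: "d > 0" "\<And>f. f \<in> F \<Longrightarrow> d \<le> cmod (c f n)"
    using lead unfolding closure_approachable by (force simp: not_less)
  \<comment> \<open>The threshold is chosen so that, after dividing the root bound by
    \<open>d\<close>, a root within distance \<open>e\<close> of \<open>z\<close> remains.\<close>
  obtain f where f: "f \<in> F" "cmod (\<Sum>k\<le>n. z ^ k * c f k) < d * e ^ n"
    using small[of "d * e ^ n"] d(1) e by auto
  define p where "p = (\<Sum>k\<le>n. monom (c f k) k)"
  have poly_p: "poly p w = (\<Sum>k\<le>n. w ^ k * c f k)" for w
    by (simp add: p_def poly_sum poly_monom mult.commute)
  have coeff_p: "coeff p k = (if k \<le> n then c f k else 0)" for k
    by (simp add: p_def coeff_sum)
  \<comment> \<open>The degree is exactly \<open>n\<close> whichever \<open>f\<close> was picked, so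
    the exponent matches the one in the threshold.\<close>
  have "c f n \<noteq> 0" using d f(1) by force
  then have deg: "degree p = n"
    by (intro antisym degree_le le_degree) (auto simp: coeff_p)
  obtain w where w: "poly p w = 0" "cmod (c f n) * cmod (z - w) ^ n \<le> cmod (poly p z)"
    using exists_root_near[of p z] n deg coeff_p[of n] by auto
  have "d * cmod (z - w) ^ n \<le> cmod (c f n) * cmod (z - w) ^ n"
    using d(2)[OF f(1)] by (intro mult_right_mono) auto
  also have "\<dots> < d * e ^ n"
    using w(2) f(2) unfolding poly_p by linarith
  finally have "cmod (z - w) ^ n < e ^ n"
    using d(1) by simp
  then have "dist w z < e"
    using e by (metis dist_commute dist_norm less_eq_real_def power_less_imp_less_base)
  then show "\<exists>w\<in>{w. \<exists>f\<in>F. (\<Sum>k\<le>n. w ^ k * c f k) = 0}. dist w z < e"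
    using w(1) f(1) unfolding poly_p by blast
qed

lemma cinner_zero_left [simp]: "cinner 0 y = 0"
  using cinner_add_left[of 0 0 y] by simp

lemma cinner_sum_left: "cinner (\<Sum>k\<in>S. g k) y = (\<Sum>k\<in>S. cinner (g k) y)"
  by (induction S rule: infinite_finite_induct) (simp_all add: cinner_add_left)

text \<open>Cauchy-Schwarz against a unit vector: removing from \<open>g\<close> its projection onto
  \<open>f\<close> leaves \<open>h\<close> orthogonal to \<open>f\<close>, and Pythagoras gives
  \<open>(norm g)\<^sup>2 - (cmod c)\<^sup>2 = (norm h)\<^sup>2\<close>, which is
  nonnegative.\<close>

lemma cmod_cinner_unit_le:
  assumes "norm f = 1"
  shows "cmod (cinner g f) \<le> norm g"
proof -
  define c where "c = cinner g f"
  define h where "h = g + (- c) *\<^sub>C f"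
  have hf: "cinner h f = 0"
    using cinner_self[of f] assms
    by (simp add: h_def c_def cinner_add_left cinner_scaleC_left
        del: complex_vector.scale_minus_left add_uminus_conv_diff)
  then have fh: "cinner f h = 0"
    by (subst cinner_commute) simp
  have "cinner h h = cinner g h"
    using fh by (subst (1) h_def)
      (simp add: cinner_add_left cinner_scaleC_left
        del: complex_vector.scale_minus_left add_uminus_conv_diff)
  also have "\<dots> = cnj (cinner h g)" by (rule cinner_commute)
  \<comment> \<open>Here \<open>cinner f g = cnj c\<close>; the right-hand side is real, so the
    conjugation disappears.\<close>
  also have "cinner h g = cinner g g - c * cnj c"
    using cinner_commute[of f g]
    by (simp add: h_def c_def cinner_add_left cinner_scaleC_left
        del: complex_vector.scale_minus_left)
  finally have "complex_of_real ((norm h)\<^sup>2) = complex_of_real ((norm g)\<^sup>2 - (cmod c)\<^sup>2)"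
    by (simp add: cinner_self complex_norm_square mult.commute del: of_real_power)
  then have "(norm h)\<^sup>2 = (norm g)\<^sup>2 - (cmod c)\<^sup>2"
    using of_real_eq_iff by blast
  then have "(cmod c)\<^sup>2 \<le> (norm g)\<^sup>2"
    using zero_le_power2[of "norm h"] by linarith
  then show ?thesis
    unfolding c_def by (rule power2_le_imp_le) simp
qed

text \<open>The supremum is taken over the reals, so it is an upper bound only once the boundedness
  constant \<open>K\<close> shows the set to be bounded above.\<close>

lemma cmod_le_form_norm:
  assumes "b \<in> bounded_forms" "norm f = 1" "norm g = 1"
  shows "cmod (b f g) \<le> form_norm b"
proof -
  obtain K where K: "cmod (b f g) \<le> K * norm f * norm g" for f g
    using assms(1) by (auto simp: bounded_forms_def)
  have "bdd_above {cmod (b f g) |f g. norm f = 1 \<and> norm g = 1}"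
  proof (rule bdd_aboveI[of _ K])
    fix x assume "x \<in> {cmod (b f g) |f g. norm f = 1 \<and> norm g = 1}"
    then obtain f g where "x = cmod (b f g)" "norm f = 1" "norm g = 1" by auto
    then show "x \<le> K" using K[of f g] by simp
  qed
  then show ?thesis
    unfolding form_norm_def using assms by (intro cSup_upper) auto
qed

text \<open>A perturbation \<open>B\<close> putting \<open>z\<close> into the numerical range must
  cancel the quadratic form of \<open>T z\<close> at some unit vector \<open>f\<close>, so that form
  is at most \<open>onorm B\<close> in modulus there.\<close>

lemma pseudo_num_rangeD:
  assumes "z \<in> pseudo_num_range T" "\<epsilon> > 0"
  shows "\<exists>f\<in>op_dom (T z). norm f = 1 \<and> cmod (cinner (op_app (T z) f) f) < \<epsilon>"
proof -
  obtain B f where B: "B \<in> bounded_ops" "onorm B < \<epsilon>" and f: "f \<in> op_dom (T z)" "norm f = 1"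
    and eq: "cinner (op_app (T z) f + B f) f = 0"
    using assms by (fastforce simp: pseudo_num_range_def eps_num_range_def fam_num_range_def
        num_range_def op_add_def)
  have "cinner (op_app (T z) f) f = - cinner (B f) f"
    using eq by (simp add: cinner_add_left eq_neg_iff_add_eq_0)
  then have "cmod (cinner (op_app (T z) f) f) = cmod (cinner (B f) f)" by simp
  also have "\<dots> \<le> norm (B f)" using f(2) by (rule cmod_cinner_unit_le)
  also have "\<dots> \<le> onorm B" using onorm[of B f] B(1) f(2) by (simp add: bounded_ops_def)
  finally show ?thesis using B(2) f by force
qed

lemma form_pseudo_num_rangeD:
  assumes "z \<in> form_pseudo_num_range t" "\<epsilon> > 0"
  shows "\<exists>f\<in>form_dom (t z). norm f = 1 \<and> cmod (form_app (t z) f f) < \<epsilon>"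
proof -
  obtain b f where b: "b \<in> bounded_forms" "form_norm b < \<epsilon>"
    and f: "f \<in> form_dom (t z)" "norm f = 1" and eq: "form_app (t z) f f + b f f = 0"
    using assms by (fastforce simp: form_pseudo_num_range_def form_eps_num_range_def
        form_fam_num_range_def form_num_range_def form_add_def)
  have "cmod (form_app (t z) f f) = cmod (b f f)"
    using eq by (metis eq_neg_iff_add_eq_0 norm_minus_cancel)
  also have "\<dots> \<le> form_norm b" using b(1) f(2) by (intro cmod_le_form_norm)
  finally show ?thesis using b(2) f by force
qed

lemma pseudo_num_range_op_poly:
  assumes "n \<ge> 1" and "0 \<notin> closure (num_range (A n))"
  shows "pseudo_num_range (op_poly n A) \<subseteq> closure (fam_num_range (op_poly n A))"
proof
  fix z
  assume z: "z \<in> pseudo_num_range (op_poly n A)"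
  define F where "F = {f. f \<in> (\<Inter>k\<le>n. op_dom (A k)) \<and> norm f = 1}"
  define c where "c f k = cinner (op_app (A k) f) f" for f k
  have app: "cinner (op_app (op_poly n A w) f) f = (\<Sum>k\<le>n. w ^ k * c f k)" for w f
    by (simp add: op_poly_def c_def cinner_sum_left cinner_scaleC_left)
  \<comment> \<open>Only an inclusion: \<open>F\<close> is the unit sphere of the common domain,
    which may be smaller than \<open>op_dom (A n)\<close>.\<close>
  have "{c f n |f. f \<in> F} \<subseteq> num_range (A n)"
    by (auto simp: F_def c_def num_range_def)
  then have "0 \<notin> closure {c f n |f. f \<in> F}"
    using assms(2) closure_mono by blast
  moreover have "\<exists>f\<in>F. cmod (\<Sum>k\<le>n. z ^ k * c f k) < \<epsilon>" if "\<epsilon> > 0" for \<epsilon>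
    using pseudo_num_rangeD[OF z that] unfolding app by (auto simp: F_def op_poly_def)
  ultimately have "z \<in> closure {w. \<exists>f\<in>F. (\<Sum>k\<le>n. w ^ k * c f k) = 0}"
    using assms(1) by (intro closure_roots_of_poly_family)
  also have "{w. \<exists>f\<in>F. (\<Sum>k\<le>n. w ^ k * c f k) = 0} = fam_num_range (op_poly n A)"
    unfolding fam_num_range_def num_range_def app by (auto simp: F_def op_poly_def)
  finally show "z \<in> closure (fam_num_range (op_poly n A))" .
qed

lemma form_pseudo_num_range_form_poly:
  assumes "n \<ge> 1" and "0 \<notin> closure (form_num_range (a n))"
  shows "form_pseudo_num_range (form_poly n a) \<subseteq> closure (form_fam_num_range (form_poly n a))"
proof
  fix z
  assume z: "z \<in> form_pseudo_num_range (form_poly n a)"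
  define F where "F = {f. f \<in> (\<Inter>k\<le>n. form_dom (a k)) \<and> norm f = 1}"
  define c where "c f k = form_app (a k) f f" for f k
  have app: "form_app (form_poly n a w) f f = (\<Sum>k\<le>n. w ^ k * c f k)" for w f
    by (simp add: form_poly_def c_def)
  have "{c f n |f. f \<in> F} \<subseteq> form_num_range (a n)"
    by (auto simp: F_def c_def form_num_range_def)
  then have "0 \<notin> closure {c f n |f. f \<in> F}"
    using assms(2) closure_mono by blast
  moreover have "\<exists>f\<in>F. cmod (\<Sum>k\<le>n. z ^ k * c f k) < \<epsilon>" if "\<epsilon> > 0" for \<epsilon>
    using form_pseudo_num_rangeD[OF z that] unfolding app by (auto simp: F_def form_poly_def)
  ultimately have "z \<in> closure {w. \<exists>f\<in>F. (\<Sum>k\<le>n. w ^ k * c f k) = 0}"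
    using assms(1) by (intro closure_roots_of_poly_family)
  \<comment> \<open>The domain of \<open>form_poly n a w\<close> does not vary with
    \<open>w\<close>, so the same \<open>F\<close> supplies the unit vectors at the root
    \<open>w\<close> as at \<open>z\<close>.\<close>
  also have "{w. \<exists>f\<in>F. (\<Sum>k\<le>n. w ^ k * c f k) = 0} = form_fam_num_range (form_poly n a)"
    unfolding form_fam_num_range_def form_num_range_def app by (auto simp: F_def form_poly_def)
  finally show "z \<in> closure (form_fam_num_range (form_poly n a))" .
qed

theorem proposition2p7:
  fixes n :: nat
    and A :: "nat \<Rightarrow> 'a::chilbert_space unbounded_op"
    and a :: "nat \<Rightarrow> 'a unbounded_form"
  assumes "n \<ge> 1"
  shows "((\<forall>k\<le>n. linear_op (A k)) \<and> 0 \<notin> closure (num_range (A n)) \<longrightarrow>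
            pseudo_num_range (op_poly n A) \<subseteq> closure (fam_num_range (op_poly n A))) \<and>
         ((\<forall>k\<le>n. sesquilinear_form (a k)) \<and> 0 \<notin> closure (form_num_range (a n)) \<longrightarrow>
            form_pseudo_num_range (form_poly n a) \<subseteq> closure (form_fam_num_range (form_poly n a)))"
  using assms by (intro conjI impI pseudo_num_range_op_poly form_pseudo_num_range_form_poly) auto

end
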